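(* Let $a<b$ be real numbers and let $u:[a,b]\to\mathbb{R}$ be four times continuously differentiable on $[a,b]$. Then for every $x\in(a,b)$ there exist $\gamma>0$ and $\Gamma>0$ such that for every $\Delta x>0$ with $x+\Delta x\in(a,b)$, $x-\Delta x\in(a,b)$ and $\Delta x<\gamma$, $$\left|\frac{u(x+\Delta x)-2u(x)+u(x-\Delta x)}{(\Delta x)^2}-\frac{d^2u}{dx^2}(x)\right|\le \Gamma\,(\Delta x)^2 .$$ *)

theory Defs
  imports "HOL-Analysis.Analysis"
begin

(* f is k times continuously differentiable on S. The derivatives are taken within S, so at an
   endpoint of a closed interval they are one-sided. On a set with isolated points the witness f'
   is not unique; for an interval with more than one point it is. *)
fun k_times_cont_diff_on :: "nat \<Rightarrow> (real \<Rightarrow> real) \<Rightarrow> real set \<Rightarrow> bool" where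
  "k_times_cont_diff_on 0 f S \<longleftrightarrow> continuous_on S f"
| "k_times_cont_diff_on (Suc k) f S \<longleftrightarrow>
     (\<exists>f'. (\<forall>x\<in>S. (f has_real_derivative f' x) (at x within S)) \<and> k_times_cont_diff_on k f' S)"

end

theory Submission
  imports Defs
begin

text \<open>
  Expand \<open>u (x + h)\<close> and \<open>u (x - h)\<close> to third order about \<open>x\<close> with Lagrange remainder. When the two
  expansions are added, the terms of odd order cancel, \<open>2 * u x\<close> is removed by the difference
  quotient and \<open>h\<^sup>2 * u'' x\<close> is the leading term; what is left is
  \<open>(u'''' s + u'''' t) * h ^ 4 / 24\<close> for intermediate points \<open>s\<close> and \<open>t\<close>
  (\<open>second_difference_remainder\<close>). The fourth derivative is continuous on the compact interval
  \<open>{a..b}\<close>, so it is bounded there by some \<open>M\<close>, and dividing by \<open>h\<^sup>2\<close> gives the error bound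
  \<open>M / 12 * h\<^sup>2\<close>.
\<close>

text \<open>
  Both expansions are instances of \<open>Taylor\<close>, whose derivatives are two-sided also at the end points
  of the interval; hence the hypothesis on all of \<open>{x - h..x + h}\<close>.
\<close>
lemma second_difference_remainder:
  fixes u u1 u2 u3 u4 :: "real \<Rightarrow> real"
  assumes "h > 0"
    and d1: "\<And>t. t \<in> {x - h..x + h} \<Longrightarrow> (u has_real_derivative u1 t) (at t)"
    and d2: "\<And>t. t \<in> {x - h..x + h} \<Longrightarrow> (u1 has_real_derivative u2 t) (at t)"
    and d3: "\<And>t. t \<in> {x - h..x + h} \<Longrightarrow> (u2 has_real_derivative u3 t) (at t)"
    and d4: "\<And>t. t \<in> {x - h..x + h} \<Longrightarrow> (u3 has_real_derivative u4 t) (at t)"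
  obtains s t where "s \<in> {x - h..x + h}" "t \<in> {x - h..x + h}"
    "u (x + h) - 2 * u x + u (x - h) = h\<^sup>2 * u2 x + (u4 s + u4 t) * h ^ 4 / 24"
proof -
  define D where "D m = [u, u1, u2, u3, u4] ! m" for m
  have D: "(D m has_real_derivative D (Suc m) t) (at t)" if "m < 4" "x - h \<le> t" "t \<le> x + h" for m t
    using that d1 d2 d3 d4 unfolding D_def by (auto simp: less_Suc_eq numeral_eq_Suc)
  have expansion: "\<exists>t\<in>{x - h..x + h}.
      u y = u x + u1 x * (y - x) + u2 x * (y - x)\<^sup>2 / 2 + u3 x * (y - x) ^ 3 / 6 + u4 t * (y - x) ^ 4 / 24"
    if "y \<in> {x - h..x + h}" "y \<noteq> x" for y
  proof -
    have "\<exists>t. (if y < x then y < t \<and> t < x else x < t \<and> t < y) \<and>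
        u y = (\<Sum>m<4. D m x / fact m * (y - x) ^ m) + D 4 t / fact 4 * (y - x) ^ 4"
      using that \<open>h > 0\<close> D by (intro Taylor[where a = "x - h" and b = "x + h"]) (auto simp: D_def)
    then obtain t where t: "if y < x then y < t \<and> t < x else x < t \<and> t < y"
      and e: "u y = (\<Sum>m<4. D m x / fact m * (y - x) ^ m) + D 4 t / fact 4 * (y - x) ^ 4"
      by blast
    have "t \<in> {x - h..x + h}"
      using t that by (auto split: if_splits)
    moreover have "u y = u x + u1 x * (y - x) + u2 x * (y - x)\<^sup>2 / 2 + u3 x * (y - x) ^ 3 / 6
        + u4 t * (y - x) ^ 4 / 24"
      using e by (simp add: D_def numeral_eq_Suc fact_numeral)
    ultimately show ?thesis by blast
  qed
  obtain s where s: "s \<in> {x - h..x + h}"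
    "u (x + h) = u x + u1 x * h + u2 x * h\<^sup>2 / 2 + u3 x * h ^ 3 / 6 + u4 s * h ^ 4 / 24"
    using expansion[of "x + h"] \<open>h > 0\<close> by auto
  obtain t where t: "t \<in> {x - h..x + h}"
    "u (x - h) = u x - u1 x * h + u2 x * h\<^sup>2 / 2 - u3 x * h ^ 3 / 6 + u4 t * h ^ 4 / 24"
    using expansion[of "x - h"] \<open>h > 0\<close> by auto
  show thesis
    using s t by (intro that[of s t]) (auto simp: field_simps)
qed

theorem mainTheorem2:
  fixes a b :: real and u :: "real \<Rightarrow> real"
  assumes "a < b"
    and "k_times_cont_diff_on 4 u {a..b}"
  shows "\<forall>x\<in>{a<..<b}. \<exists>\<gamma>>0. \<exists>\<Gamma>>0. \<forall>\<Delta>x>0.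
           x + \<Delta>x \<in> {a<..<b} \<longrightarrow> x - \<Delta>x \<in> {a<..<b} \<longrightarrow> \<Delta>x < \<gamma> \<longrightarrow>
           \<bar>(u (x + \<Delta>x) - 2 * u x + u (x - \<Delta>x)) / \<Delta>x\<^sup>2 - (deriv ^^ 2) u x\<bar> \<le> \<Gamma> * \<Delta>x\<^sup>2"
proof -
  have "k_times_cont_diff_on (Suc (Suc (Suc (Suc 0)))) u {a..b}"
    using assms(2) by (simp only: numeral_eq_Suc pred_numeral_simps BitM.simps)
  then obtain u1 u2 u3 u4 where
    w: "\<And>t. t \<in> {a..b} \<Longrightarrow> (u has_real_derivative u1 t) (at t within {a..b})"
       "\<And>t. t \<in> {a..b} \<Longrightarrow> (u1 has_real_derivative u2 t) (at t within {a..b})"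
       "\<And>t. t \<in> {a..b} \<Longrightarrow> (u2 has_real_derivative u3 t) (at t within {a..b})"
       "\<And>t. t \<in> {a..b} \<Longrightarrow> (u3 has_real_derivative u4 t) (at t within {a..b})"
    and cont: "continuous_on {a..b} u4"
    unfolding k_times_cont_diff_on.simps by blast
  have interior: "(f has_real_derivative f' t) (at t)"
    if "\<And>t. t \<in> {a..b} \<Longrightarrow> (f has_real_derivative f' t) (at t within {a..b})" "t \<in> {a<..<b}" for f f' t
    using that(1)[of t] that(2) at_within_Icc_at[of a t b] by auto
  have d:
    "\<And>t. t \<in> {a<..<b} \<Longrightarrow> (u has_real_derivative u1 t) (at t)"
    "\<And>t. t \<in> {a<..<b} \<Longrightarrow> (u1 has_real_derivative u2 t) (at t)"
    "\<And>t. t \<in> {a<..<b} \<Longrightarrow> (u2 has_real_derivative u3 t) (at t)"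
    "\<And>t. t \<in> {a<..<b} \<Longrightarrow> (u3 has_real_derivative u4 t) (at t)"
    by (blast intro: interior w)+
  have second_deriv: "(deriv ^^ 2) u x = u2 x" if x: "x \<in> {a<..<b}" for x
  proof -
    \<comment> \<open>The outer derivative looks at \<open>deriv u\<close> near \<open>x\<close>, where it agrees with \<open>u1\<close>.\<close>
    have "(deriv u has_real_derivative u2 x) (at x)"
      using d(2)[OF x] open_greaterThanLessThan x
      by (rule has_field_derivative_transform_within_open) (rule DERIV_imp_deriv[OF d(1), symmetric])
    then show ?thesis
      by (simp add: numeral_2_eq_2 DERIV_imp_deriv)
  qed
  have "bounded (u4 ` {a..b})"
    using cont by (intro compact_imp_bounded compact_continuous_image) auto
  then obtain M where M: "M > 0" "\<And>t. t \<in> {a..b} \<Longrightarrow> \<bar>u4 t\<bar> \<le> M"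
    by (auto simp: bounded_pos)
  have bound: "\<bar>(u (x + h) - 2 * u x + u (x - h)) / h\<^sup>2 - (deriv ^^ 2) u x\<bar> \<le> M / 12 * h\<^sup>2"
    if x: "x \<in> {a<..<b}" and h: "h > 0" "x + h \<in> {a<..<b}" "x - h \<in> {a<..<b}" for x h
  proof -
    have sub: "{x - h..x + h} \<subseteq> {a<..<b}"
      using h by auto
    obtain s t where st: "s \<in> {x - h..x + h}" "t \<in> {x - h..x + h}"
      and e: "u (x + h) - 2 * u x + u (x - h) = h\<^sup>2 * u2 x + (u4 s + u4 t) * h ^ 4 / 24"
      by (rule second_difference_remainder[OF h(1) d[OF subsetD[OF sub]]])
    have "(u (x + h) - 2 * u x + u (x - h)) / h\<^sup>2 - (deriv ^^ 2) u x = (u4 s + u4 t) / 24 * h\<^sup>2"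
      unfolding e second_deriv[OF x] using h(1) by (simp add: field_simps power_numeral_reduce)
    moreover have "\<bar>(u4 s + u4 t) / 24\<bar> \<le> M / 12"
      using M(2)[of s] M(2)[of t] st sub by fastforce
    ultimately show ?thesis
      by (simp only: abs_mult abs_power2 mult_right_mono zero_le_power2)
  qed
  show ?thesis
  proof
    \<comment> \<open>The bound is uniform in \<open>x\<close> and \<open>h\<close>; the choice of \<open>\<gamma> = 1\<close> is arbitrary.\<close>
    fix x assume "x \<in> {a<..<b}"
    with bound M(1) show "\<exists>\<gamma>>0. \<exists>\<Gamma>>0. \<forall>\<Delta>x>0.
        x + \<Delta>x \<in> {a<..<b} \<longrightarrow> x - \<Delta>x \<in> {a<..<b} \<longrightarrow> \<Delta>x < \<gamma> \<longrightarrow>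
        \<bar>(u (x + \<Delta>x) - 2 * u x + u (x - \<Delta>x)) / \<Delta>x\<^sup>2 - (deriv ^^ 2) u x\<bar> \<le> \<Gamma> * \<Delta>x\<^sup>2"
      by (intro exI[of _ 1] exI[of _ "M / 12"] conjI) auto
  qed
qed

end
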